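(* The space $\ell_\infty$ does not include the spaces $c_{0}(\widehat{F})$ and $c(\widehat{F})$; that is, $c_0(\widehat{F})\not\subseteq\ell_\infty$ and $c(\widehat{F})\not\subseteq\ell_\infty$.
   Context: Let $\mathbb{N}=\{0,1,2,\dots\}$ and let $\omega$ be the vector space of all real sequences $x=(x_k)_{k\in\mathbb{N}}$. The Fibonacci numbers are defined by $f_0=f_1=1$ and $f_n=f_{n-1}+f_{n-2}$ for $n\ge 2$. For $x\in\omega$ the $\widehat{F}$-transform $\widehat{F}x=(\widehat{F}_n(x))_{n\in\mathbb{N}}$ is defined by $\widehat{F}_0(x)=x_0$ and $\widehat{F}_n(x)=\frac{f_n}{f_{n+1}}x_n-\frac{f_{n+1}}{f_n}x_{n-1}$ for $n\ge1$. Let $c_0$, $c$ and $\ell_\infty$ be the spaces of null, convergent and bounded sequences, and put $c_0(\widehat{F})=\{x\in\omega:\widehat{F}x\in c_0\}$ and $c(\widehat{F})=\{x\in\omega:\widehat{F}x\in c\}$. *)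

theory Defs
  imports Complex_Main "HOL-Number_Theory.Fib"
begin

text \<open>The Fibonacci numbers are normalised by \<open>f\<^sub>0 = f\<^sub>1 = 1\<close>, whereas the library's
  \<^const>\<open>fib\<close> starts with \<open>fib 0 = 0\<close>; hence the index shift.\<close>

definition fibo :: "nat \<Rightarrow> nat" where
  "fibo n = fib (Suc n)"

lemma fibo_0: "fibo 0 = 1"
  and fibo_1: "fibo 1 = 1"
  and fibo_rec: "n \<ge> 2 \<Longrightarrow> fibo n = fibo (n - 1) + fibo (n - 2)"
proof -
  show "fibo 0 = 1" "fibo 1 = 1"
    by (simp_all add: fibo_def)
  assume "n \<ge> 2"
  then obtain m where "n = Suc (Suc m)"
    by (metis add_2_eq_Suc le_Suc_ex)
  then show "fibo n = fibo (n - 1) + fibo (n - 2)"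
    by (simp add: fibo_def)
qed

definition F_hat :: "(nat \<Rightarrow> real) \<Rightarrow> nat \<Rightarrow> real" where
  "F_hat x n =
    (if n = 0 then x 0
     else real (fibo n) / real (fibo (n + 1)) * x n
        - real (fibo (n + 1)) / real (fibo n) * x (n - 1))"

definition null_seqs :: "(nat \<Rightarrow> real) set" where
  "null_seqs = {x. x \<longlonglongrightarrow> 0}"

definition convergent_seqs :: "(nat \<Rightarrow> real) set" where
  "convergent_seqs = {x. convergent x}"

definition bounded_seqs :: "(nat \<Rightarrow> real) set" where
  "bounded_seqs = {x. Bseq x}"

definition F_hat_domain :: "(nat \<Rightarrow> real) set \<Rightarrow> (nat \<Rightarrow> real) set" where
  "F_hat_domain X = {x. F_hat x \<in> X}"

end

theory Submission
  imports Defs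
begin

text \<open>A sequence with \<open>F_hat x n = 0\<close> for all \<open>n \<ge> 1\<close> is determined by \<open>x 0\<close>: the recurrence
  forces \<open>x n = (f (n + 1) / f n)\<^sup>2 x (n - 1)\<close>, and the product of these ratios telescopes to
  \<open>x n = (f (n + 1))\<^sup>2 x 0\<close>. For \<open>x 0 = 1\<close> this is the sequence of squared Fibonacci numbers, which
  is unbounded although its transform \<open>(1, 0, 0, \<dots>)\<close> tends to zero. This one sequence settles
  both non-inclusions, since null sequences converge.\<close>

definition fibo_squares :: "nat \<Rightarrow> real" where
  "fibo_squares n = (real (fibo (n + 1)))\<^sup>2"

lemma F_hat_fibo_squares: "F_hat fibo_squares n = (if n = 0 then 1 else 0)"
proof -
  have "fibo k \<noteq> 0" for k
    by (simp add: fibo_def fib_neq_0_nat)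
  then show ?thesis
    using fibo_1 by (simp add: F_hat_def fibo_squares_def power2_eq_square)
qed

lemma less_fibo_Suc: "n < fibo (n + 1)"
proof (induction n)
  case 0
  then show ?case by (simp add: fibo_def)
next
  case (Suc n)
  have "fib (Suc n) > 0" by (simp add: fib_neq_0_nat)
  with Suc show ?case by (simp add: fibo_def)
qed

lemma not_Bseq_fibo_squares: "\<not> Bseq fibo_squares"
proof
  assume "Bseq fibo_squares"
  then obtain K where K: "\<And>n. norm (fibo_squares n) \<le> K"
    by (metis BseqE)
  obtain n :: nat where "K < real n"
    using reals_Archimedean2 by blast
  also have "real n \<le> real (fibo (n + 1))"
    using less_fibo_Suc [of n] by simp
  also have "\<dots> \<le> real (fibo (n + 1)) ^ 2"
    using less_fibo_Suc [of n] by (intro self_le_power) auto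
  also have "\<dots> = norm (fibo_squares n)"
    by (simp add: fibo_squares_def)
  finally show False
    using K [of n] by simp
qed

theorem theorem3p5:
  shows "\<not> F_hat_domain null_seqs \<subseteq> bounded_seqs \<and>
         \<not> F_hat_domain convergent_seqs \<subseteq> bounded_seqs"
proof -
  have "eventually (\<lambda>n. F_hat fibo_squares n = 0) sequentially"
    using eventually_gt_at_top [of 0] by eventually_elim (simp add: F_hat_fibo_squares)
  then have "F_hat fibo_squares \<longlonglongrightarrow> 0"
    by (rule tendsto_eventually)
  then have "fibo_squares \<in> F_hat_domain null_seqs"
    and "fibo_squares \<in> F_hat_domain convergent_seqs"
    by (auto simp: F_hat_domain_def null_seqs_def convergent_seqs_def convergent_def)
  moreover have "fibo_squares \<notin> bounded_seqs"
    using not_Bseq_fibo_squares by (simp add: bounded_seqs_def)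
  ultimately show ?thesis
    by blast
qed

end
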